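(* Let $j \geq 2$ and $k \geq 1$ be integers and let $N = 2j^k$. Then the set $\{1, 2, \ldots, N\}$ of the first $N$ consecutive positive integers can be separated, in at least $\{(j-1)!\}^{k-1}$ ways, into $j$ sets $A_1, \ldots, A_j$, each consisting of $2j^{k-1}$ integers, such that $$\sum_{a \in A_1} a^r = \sum_{a \in A_2} a^r = \cdots = \sum_{a \in A_j} a^r \quad \text{for every } r = 1, 2, \ldots, k.$$
   Context: To separate $\{1,\ldots,N\}$ into $j$ sets means to partition it into $j$ pairwise disjoint sets whose union is $\{1,\ldots,N\}$. Different "ways" are different partitions, a partition being regarded as an unordered collection of $j$ sets (permuting the labels of $A_1,\ldots,A_j$ does not give a new way). *)

theory Defs
  imports Main "HOL-Library.Disjoint_Sets"
begin

definition equal_power_sum_partitions :: "nat \<Rightarrow> nat \<Rightarrow> nat set set set" where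
  "equal_power_sum_partitions j k =
    {P. partition_on {1..2 * j ^ k} P \<and> card P = j \<and>
        (\<forall>A\<in>P. card A = 2 * j ^ (k - 1)) \<and>
        (\<forall>r\<in>{1..k}. \<forall>A\<in>P. \<forall>B\<in>P. (\<Sum>a\<in>A. a ^ r) = (\<Sum>b\<in>B. b ^ r))}"

end

theory Submission
  imports Defs "HOL-Combinatorics.Permutations"
begin

text \<open>
  The proof is an induction on \<open>k\<close> in which every partition for \<open>k\<close> produces \<open>(j - 1)!\<close>
  partitions for \<open>k + 1\<close>, all of them different.

  For \<open>k = 1\<close> the complementary pairs \<open>{i, 2j + 1 - i}\<close> form a partition of \<open>{1..2j}\<close> of the
  required kind. For the step, write \<open>M = 2j\<^sup>k\<close> and let \<open>e 0, ..., e (j - 1)\<close> enumerate the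
  classes of a partition of \<open>{1..M}\<close>. The interval \<open>{1..jM}\<close> consists of \<open>j\<close> translates of
  \<open>{1..M}\<close>. Given a permutation \<open>s\<close> of \<open>{0..<j}\<close> that fixes \<open>0\<close>, the \<open>i\<close>-th new class takes from
  the translate by \<open>tM\<close> the copy of \<open>e ((i + s t) mod j)\<close>. The table \<open>(i, t) \<mapsto> (i + s t) mod j\<close>
  is a Latin square: each column uses every old class once, so the new classes partition
  \<open>{1..jM}\<close>; each row uses every old class once, and this equalises the power sums up to the
  exponent \<open>k + 1\<close> (\<open>power_sum_interleave\<close>). Indeed, in the binomial expansion of
  \<open>(tM + a)\<^sup>r\<close> with \<open>r \<le> k + 1\<close>, the powers of \<open>a\<close> with exponent less than \<open>r\<close> have the same sum
  over every old class, and the terms \<open>a\<^sup>r\<close> add up along a row to the sum over the whole of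
  \<open>{1..M}\<close>.

  Nothing is counted twice. Since \<open>s 0 = 0\<close>, intersecting the new classes with \<open>{1..M}\<close> gives
  back the old partition (\<open>first_block_of_interleaving\<close>), and the class that continues \<open>e 0\<close>
  shows the value of \<open>s t\<close> in the translate by \<open>tM\<close>
  (\<open>interleaving_determines_permutation\<close>).
\<close>

section \<open>Cyclic interleaving of translates of a partition\<close>

lemma bij_betw_add_mod:
  fixes c j :: nat
  assumes "j > 0"
  shows "bij_betw (\<lambda>i. (i + c) mod j) {..<j} {..<j}"
proof -
  have "inj_on (\<lambda>i. (i + c) mod j) {..<j}"
  proof (rule inj_onI)
    fix x y assume xy: "x \<in> {..<j}" "y \<in> {..<j}" "(x + c) mod j = (y + c) mod j"
    then have "int j dvd int x - int y"
      by (metis add_diff_cancel_right mod_eq_dvd_iff of_nat_add zmod_int)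
    then show "x = y"
      using xy zdvd_imp_le[of "int j" "int x - int y"] zdvd_imp_le[of "int j" "int y - int x"]
      by (cases "x < y"; cases "y < x") (auto simp: dvd_diff_commute)
  qed
  moreover have "(\<lambda>i. (i + c) mod j) ` {..<j} \<subseteq> {..<j}"
    using assms by auto
  ultimately show ?thesis
    by (simp add: bij_betw_def endo_inj_surj)
qed

lemma bij_betw_permute_add_mod:
  fixes i j :: nat
  assumes "j > 0" and "s permutes {1..<j}"
  shows "bij_betw (\<lambda>t. (i + s t) mod j) {..<j} {..<j}"
proof -
  have "s permutes {..<j}"
    using assms(2) by (rule permutes_subset) auto
  then have "bij_betw s {..<j} {..<j}"
    by (rule permutes_imp_bij)
  from bij_betw_trans[OF this bij_betw_add_mod[OF assms(1), of i]]
  show ?thesis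
    by (simp add: comp_def add.commute)
qed

text \<open>
  Division with remainder, with remainders taken in \<open>{1..M}\<close> instead of \<open>{0..<M}\<close>; hence the
  quotient of \<open>x\<close> is \<open>(x - 1) div M\<close>.
\<close>
lemma block_decomposition_unique:
  fixes M t t' a a' :: nat
  assumes "t * M + a = t' * M + a'" and "a \<in> {1..M}" and "a' \<in> {1..M}"
  shows "t = t' \<and> a = a'"
proof -
  have "t = (t * M + a - 1) div M" if "a \<in> {1..M}" for t a
  proof -
    have "t * M + a - 1 = (a - 1) + t * M" using that by auto
    moreover have "((a - 1) + t * M) div M = t + (a - 1) div M"
      using that by (intro div_mult_self1) auto
    moreover have "(a - 1) div M = 0" using that by (intro div_less) auto
    ultimately show ?thesis by presburger
  qed
  from this[OF assms(2), of t] this[OF assms(3), of t'] have "t = t'"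
    using assms(1) by simp
  then show ?thesis using assms(1) by simp
qed

lemma block_decomposition_exists:
  fixes M x j :: nat
  assumes "x \<in> {1..j * M}"
  obtains t a where "t < j" "a \<in> {1..M}" "x = t * M + a"
proof
  have M: "M > 0" using assms by (cases M) auto
  have "x - 1 < j * M" using assms by auto
  then show "(x - 1) div M < j"
    using M by (simp add: less_mult_imp_div_less)
  show "(x - 1) mod M + 1 \<in> {1..M}" using M by (auto simp: Suc_le_eq)
  show "x = (x - 1) div M * M + ((x - 1) mod M + 1)"
    using assms by (simp flip: add.assoc)
qed

text \<open>
  The \<open>i\<close>-th new class when \<open>e\<close> enumerates the old classes inside \<open>{1..M}\<close> and the assignment of
  old to new classes is rotated by \<open>s t\<close> in the \<open>t\<close>-th translate.
\<close>
definition interleave :: "nat \<Rightarrow> nat \<Rightarrow> (nat \<Rightarrow> nat set) \<Rightarrow> (nat \<Rightarrow> nat) \<Rightarrow> nat \<Rightarrow> nat set" where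
  "interleave j M e s i = (\<Union>t<j. (\<lambda>a. t * M + a) ` e ((i + s t) mod j))"

locale enumerated_partition =
  fixes j M :: nat and P :: "nat set set" and e :: "nat \<Rightarrow> nat set"
  assumes j_pos: "j > 0"
    and partition: "partition_on {1..M} P"
    and enum: "bij_betw e {..<j} P"
begin

lemma class_in: "n < j \<Longrightarrow> e n \<in> P"
  using enum by (auto dest: bij_betwE)

lemma class_subset: "n < j \<Longrightarrow> e n \<subseteq> {1..M}"
  using class_in partition by (auto simp: partition_on_def)

lemma class_nonempty: "n < j \<Longrightarrow> e n \<noteq> {}"
  using class_in partition_onD3[OF partition] by metis

lemma finite_class: "n < j \<Longrightarrow> finite (e n)"
  using class_subset finite_subset by blast

lemma class_index_unique:
  assumes "m < j" "n < j" "a \<in> e m" "a \<in> e n"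
  shows "m = n"
proof -
  have "e m = e n"
    using assms class_in partition_onD2[OF partition] by (auto dest: disjointD)
  then show ?thesis
    using assms enum by (auto simp: bij_betw_def inj_on_def)
qed

lemma class_index_exists:
  assumes "a \<in> {1..M}"
  obtains n where "n < j" "a \<in> e n"
  using assms partition enum unfolding partition_on_def bij_betw_def by blast

lemma mem_interleave:
  assumes "t < j" "a \<in> {1..M}"
  shows "t * M + a \<in> interleave j M e s i \<longleftrightarrow> a \<in> e ((i + s t) mod j)"
proof
  assume "t * M + a \<in> interleave j M e s i"
  then obtain t' a' where t': "t' < j" "a' \<in> e ((i + s t') mod j)" "t * M + a = t' * M + a'"
    by (auto simp: interleave_def)
  then have "a' \<in> {1..M}"
    using class_subset j_pos by (meson mod_less_divisor subsetD)
  from block_decomposition_unique[OF t'(3) assms(2) this] t'(2)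
  show "a \<in> e ((i + s t) mod j)" by simp
next
  assume "a \<in> e ((i + s t) mod j)"
  then show "t * M + a \<in> interleave j M e s i"
    using assms(1) by (auto simp: interleave_def)
qed

lemma interleave_subset: "interleave j M e s i \<subseteq> {1..j * M}"
proof
  fix x assume "x \<in> interleave j M e s i"
  then obtain t a where ta: "t < j" "a \<in> e ((i + s t) mod j)" "x = t * M + a"
    by (auto simp: interleave_def)
  then have a: "a \<in> {1..M}"
    using class_subset j_pos by (meson mod_less_divisor subsetD)
  have "x \<le> Suc t * M" using ta a by simp
  also have "\<dots> \<le> j * M" using ta by (intro mult_le_mono1) simp
  finally show "x \<in> {1..j * M}" using a ta by simp
qed

lemma interleave_nonempty: "interleave j M e s i \<noteq> {}"
  using class_nonempty[of "(i + s 0) mod j"] j_pos by (auto simp: interleave_def)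

lemma interleave_index_unique:
  assumes "i < j" "i' < j" "x \<in> interleave j M e s i" "x \<in> interleave j M e s i'"
  shows "i = i'"
proof -
  obtain t a where ta: "t < j" "a \<in> {1..M}" "x = t * M + a"
    using assms(3) interleave_subset block_decomposition_exists by blast
  have "a \<in> e ((i + s t) mod j)" "a \<in> e ((i' + s t) mod j)"
    using assms(3,4) ta by (simp_all add: mem_interleave)
  then have "(i + s t) mod j = (i' + s t) mod j"
    using j_pos by (intro class_index_unique) auto
  then show ?thesis
    using inj_onD[OF bij_betw_imp_inj_on[OF bij_betw_add_mod[OF j_pos]]] assms(1,2)
    by blast
qed

lemma inj_on_interleave: "inj_on (interleave j M e s) {..<j}"
  using interleave_index_unique interleave_nonempty
  by (intro inj_onI) (metis ex_in_conv lessThan_iff)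

text \<open>
  In each translate the old classes are merely renamed by a rotation of the indices, which is a
  bijection of \<open>{..<j}\<close>.
\<close>
lemma partition_on_interleave:
  "partition_on {1..j * M} (interleave j M e s ` {..<j})"
proof (rule partition_onI)
  show "\<Union> (interleave j M e s ` {..<j}) = {1..j * M}"
  proof (intro equalityI subsetI)
    fix x assume "x \<in> {1..j * M}"
    then obtain t a where ta: "t < j" "a \<in> {1..M}" "x = t * M + a"
      by (rule block_decomposition_exists)
    obtain n where n: "n < j" "a \<in> e n"
      using ta(2) by (rule class_index_exists)
    obtain i where "i < j" "(i + s t) mod j = n"
      using bij_betw_imp_surj_on[OF bij_betw_add_mod[OF j_pos, of "s t"]] n(1)
      by (metis (no_types, lifting) imageE lessThan_iff)
    with ta n show "x \<in> \<Union> (interleave j M e s ` {..<j})"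
      by (auto simp: mem_interleave)
  qed (use interleave_subset in blast)
next
  fix p q
  assume "p \<in> interleave j M e s ` {..<j}" "q \<in> interleave j M e s ` {..<j}" "p \<noteq> q"
  then show "disjnt p q"
    using interleave_index_unique by (fastforce simp: disjnt_iff)
next
  show "{} \<notin> interleave j M e s ` {..<j}" using interleave_nonempty by auto
qed

lemma sum_interleave:
  "sum g (interleave j M e s i) = (\<Sum>t<j. \<Sum>a\<in>e ((i + s t) mod j). g (t * M + a))"
proof -
  have cls: "e ((i + s t) mod j) \<subseteq> {1..M}" for t
    using class_subset j_pos by simp
  have "sum g (interleave j M e s i)
      = (\<Sum>t<j. sum g ((\<lambda>a. t * M + a) ` e ((i + s t) mod j)))"
    unfolding interleave_def
  proof (rule sum.UNION_disjoint)
    show "\<forall>t\<in>{..<j}. \<forall>t'\<in>{..<j}. t \<noteq> t' \<longrightarrow>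
        (\<lambda>a. t * M + a) ` e ((i + s t) mod j) \<inter> (\<lambda>a. t' * M + a) ` e ((i + s t') mod j) = {}"
    proof (intro ballI impI, rule ccontr)
      fix t t' assume "t \<noteq> t'"
        and "(\<lambda>a. t * M + a) ` e ((i + s t) mod j) \<inter> (\<lambda>a. t' * M + a) ` e ((i + s t') mod j) \<noteq> {}"
      then obtain a a' where "a \<in> e ((i + s t) mod j)" "a' \<in> e ((i + s t') mod j)"
        "t * M + a = t' * M + a'" by auto
      with \<open>t \<noteq> t'\<close> show False
        using block_decomposition_unique[of t M a t' a'] cls[of t] cls[of t'] by blast
    qed
  qed (use finite_class j_pos in auto)
  also have "\<dots> = (\<Sum>t<j. \<Sum>a\<in>e ((i + s t) mod j). g (t * M + a))"
    by (simp add: sum.reindex)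
  finally show ?thesis .
qed

lemma card_interleave:
  assumes "\<And>A. A \<in> P \<Longrightarrow> card A = c"
  shows "card (interleave j M e s i) = j * c"
proof -
  have "card (interleave j M e s i) = (\<Sum>x\<in>interleave j M e s i. 1)" by simp
  also have "\<dots> = (\<Sum>t<j. card (e ((i + s t) mod j)))"
    by (simp only: sum_interleave) simp
  also have "\<dots> = j * c"
    using assms class_in j_pos by simp
  finally show ?thesis .
qed

text \<open>
  The gain of one exponent: power sums need to agree on the old classes only for the exponents
  below \<open>r\<close>, and \<open>i\<close> does not occur on the right-hand side. For fixed \<open>i\<close>, the index
  \<open>(i + s t) mod j\<close> runs through \<open>{..<j}\<close> once as \<open>t\<close> does, so the leading terms, which may differ
  between old classes, add up to the same total in every new class. For \<open>r > 0\<close> the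
  range \<open>l < r\<close> includes \<open>l = 0\<close>: the old classes must also have equal size.
\<close>
lemma power_sum_interleave:
  assumes s: "s permutes {1..<j}"
    and common: "\<And>l A. l < r \<Longrightarrow> A \<in> P \<Longrightarrow> (\<Sum>a\<in>A. a ^ l) = q l"
  shows "(\<Sum>x\<in>interleave j M e s i. x ^ r)
    = (\<Sum>n<j. \<Sum>a\<in>e n. a ^ r) + (\<Sum>t<j. \<Sum>l<r. (r choose l) * (t * M) ^ (r - l) * q l)"
proof -
  have translate: "(\<Sum>a\<in>A. (t * M + a) ^ r)
      = (\<Sum>a\<in>A. a ^ r) + (\<Sum>l<r. (r choose l) * (t * M) ^ (r - l) * q l)"
    if "A \<in> P" for A t
  proof -
    have "(\<Sum>a\<in>A. (t * M + a) ^ r) = (\<Sum>a\<in>A. \<Sum>l\<le>r. (r choose l) * a ^ l * (t * M) ^ (r - l))"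
      by (simp add: binomial add.commute[of "t * M"])
    also have "\<dots> = (\<Sum>l\<le>r. (r choose l) * (t * M) ^ (r - l) * (\<Sum>a\<in>A. a ^ l))"
      by (subst sum.swap) (simp add: sum_distrib_left sum_distrib_right mult_ac)
    also have "\<dots> = (\<Sum>l<r. (r choose l) * (t * M) ^ (r - l) * (\<Sum>a\<in>A. a ^ l)) + (\<Sum>a\<in>A. a ^ r)"
      by (simp add: lessThan_Suc_atMost[symmetric])
    finally show ?thesis
      using common that by simp
  qed
  have "(\<Sum>x\<in>interleave j M e s i. x ^ r)
      = (\<Sum>t<j. (\<Sum>a\<in>e ((i + s t) mod j). a ^ r)
          + (\<Sum>l<r. (r choose l) * (t * M) ^ (r - l) * q l))"
    unfolding sum_interleave using class_in j_pos by (intro sum.cong refl translate) simp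
  also have "\<dots> = (\<Sum>t<j. \<Sum>a\<in>e ((i + s t) mod j). a ^ r)
      + (\<Sum>t<j. \<Sum>l<r. (r choose l) * (t * M) ^ (r - l) * q l)"
    by (rule sum.distrib)
  also have "(\<Sum>t<j. \<Sum>a\<in>e ((i + s t) mod j). a ^ r) = (\<Sum>n<j. \<Sum>a\<in>e n. a ^ r)"
    by (rule sum.reindex_bij_betw[OF bij_betw_permute_add_mod[OF j_pos s]])
  finally show ?thesis .
qed

lemma interleave_first_block:
  assumes "s permutes {1..<j}" "i < j"
  shows "interleave j M e s i \<inter> {1..M} = e i"
proof -
  have "s 0 = 0" using assms(1) by (auto simp: permutes_def)
  then show ?thesis
    using mem_interleave[of 0 _ s i] class_subset[of i] assms(2) j_pos by auto
qed

lemma first_block_of_interleaving: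
  assumes "s permutes {1..<j}"
  shows "(\<lambda>B. B \<inter> {1..M}) ` interleave j M e s ` {..<j} = P"
proof -
  have "(\<lambda>B. B \<inter> {1..M}) ` interleave j M e s ` {..<j} = e ` {..<j}"
    unfolding image_image using interleave_first_block[OF assms] by (intro image_cong) auto
  then show ?thesis using enum by (simp add: bij_betw_def)
qed

text \<open>
  The set of new classes carries no labels, so a class of one interleaving first has to be matched
  with a class of the other. The first block does this: the class containing \<open>e 0\<close> has label \<open>0\<close>
  in both. Its part in the translate by \<open>tM\<close> is a copy of \<open>e (s t)\<close>, respectively of
  \<open>e (s' t)\<close>.
\<close>
lemma interleaving_determines_permutation:
  assumes s: "s permutes {1..<j}" and s': "s' permutes {1..<j}"
    and eq: "interleave j M e s ` {..<j} = interleave j M e s' ` {..<j}"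
  shows "s = s'"
proof
  fix t
  have "interleave j M e s 0 \<in> interleave j M e s' ` {..<j}"
    using eq j_pos by blast
  then obtain i where i: "i < j" "interleave j M e s 0 = interleave j M e s' i"
    by auto
  then have "e 0 = e i"
    using interleave_first_block[OF s, of 0] interleave_first_block[OF s', of i] j_pos by simp
  then have "i = 0"
    using enum i j_pos by (auto simp: bij_betw_def inj_on_def)
  with i have same: "interleave j M e s 0 = interleave j M e s' 0" by simp
  show "s t = s' t"
  proof (cases "t < j")
    case True
    have "s permutes {..<j}" "s' permutes {..<j}"
      using s s' by (auto elim: permutes_subset)
    then have lt: "s t < j" "s' t < j"
      using True permutes_in_image by (metis lessThan_iff)+
    obtain a where a: "a \<in> e (s t)" using class_nonempty[OF lt(1)] by auto
    then have "a \<in> {1..M}" using class_subset[OF lt(1)] by auto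
    then have "a \<in> e (s' t)"
      using a same mem_interleave[OF True, of a s 0] mem_interleave[OF True, of a s' 0] lt by simp
    then show ?thesis using class_index_unique a lt by blast
  next
    case False
    then show ?thesis using s s' by (simp add: permutes_def)
  qed
qed

end

section \<open>Counting equal power sum partitions\<close>

lemma finite_equal_power_sum_partitions: "finite (equal_power_sum_partitions j k)"
proof (rule finite_subset)
  show "equal_power_sum_partitions j k \<subseteq> Pow (Pow {1..2 * j ^ k})"
    by (auto simp: equal_power_sum_partitions_def partition_on_def)
qed simp

lemma interleaving_in_equal_power_sum_partitions:
  assumes j: "j > 0" and k: "k \<ge> 1" and P: "P \<in> equal_power_sum_partitions j k"
    and e: "bij_betw e {..<j} P" and s: "s permutes {1..<j}"
  shows "interleave j (2 * j ^ k) e s ` {..<j} \<in> equal_power_sum_partitions j (Suc k)"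
proof -
  let ?B = "interleave j (2 * j ^ k) e s"
  interpret enumerated_partition j "2 * j ^ k" P e
    using P j e by unfold_locales (auto simp: equal_power_sum_partitions_def)
  define q where "q l = (\<Sum>a\<in>e 0. a ^ l)" for l
  have cardP: "card A = 2 * j ^ (k - 1)" if "A \<in> P" for A
    using P that by (auto simp: equal_power_sum_partitions_def)
  \<comment> \<open>For \<open>l = 0\<close> the power sum is the number of elements.\<close>
  have common: "(\<Sum>a\<in>A. a ^ l) = q l" if "l \<le> k" "A \<in> P" for l A
  proof (cases "l = 0")
    case True
    then show ?thesis using cardP that class_in[OF j] by (simp add: q_def)
  next
    case False
    then have "l \<in> {1..k}" using that by auto
    then show ?thesis
      using P that class_in[OF j] unfolding equal_power_sum_partitions_def q_def by blast
  qed
  have "partition_on {1..2 * j ^ Suc k} (?B ` {..<j})"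
    using partition_on_interleave[of s] by (simp add: mult_ac)
  moreover have "card (?B ` {..<j}) = j"
    using inj_on_interleave by (simp add: card_image)
  moreover have "card (?B i) = 2 * j ^ (Suc k - 1)" for i
    using card_interleave[OF cardP] k by (cases k) (auto simp: mult_ac)
  moreover have "(\<Sum>a\<in>?B i. a ^ r) = (\<Sum>b\<in>?B i'. b ^ r)" if "r \<in> {1..Suc k}" for r i i'
  proof -
    have "(\<Sum>a\<in>A. a ^ l) = q l" if "l < r" "A \<in> P" for l A
      using common \<open>r \<in> {1..Suc k}\<close> that by simp
    from power_sum_interleave[OF s this] show ?thesis by simp
  qed
  ultimately show ?thesis
    unfolding equal_power_sum_partitions_def by blast
qed

text \<open>
  One enumeration is chosen for each old partition, so that the new partition is a function of the
  pair of the old partition and the permutation; this function is injective because the first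
  block recovers the old partition and thereby the enumeration used.
\<close>
lemma card_equal_power_sum_partitions_Suc:
  assumes j: "j > 0" and k: "k \<ge> 1"
  shows "fact (j - 1) * card (equal_power_sum_partitions j k)
    \<le> card (equal_power_sum_partitions j (Suc k))"
proof -
  let ?E = "equal_power_sum_partitions j k"
  let ?S = "{s. s permutes {1..<j}}"
  have "\<forall>P\<in>?E. \<exists>e. bij_betw e {..<j} P"
  proof
    fix P assume "P \<in> ?E"
    then have "finite P" "card P = j"
      using j by (auto simp: equal_power_sum_partitions_def intro: card_ge_0_finite)
    then show "\<exists>e. bij_betw e {..<j} P"
      using ex_bij_betw_nat_finite[of P] by (simp add: atLeast0LessThan)
  qed
  from bchoice[OF this] obtain e where e: "\<And>P. P \<in> ?E \<Longrightarrow> bij_betw (e P) {..<j} P"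
    by blast
  define F where "F = (\<lambda>(P, s). interleave j (2 * j ^ k) (e P) s ` {..<j})"
  have enumerates: "enumerated_partition j (2 * j ^ k) P (e P)" if "P \<in> ?E" for P
    using that j e[OF that] by unfold_locales (auto simp: equal_power_sum_partitions_def)
  have "inj_on F (?E \<times> ?S)"
  proof (rule inj_onI, clarify)
    fix P s P' s'
    assume P: "P \<in> ?E" "P' \<in> ?E" and s: "s permutes {1..<j}" "s' permutes {1..<j}"
      and eq: "F (P, s) = F (P', s')"
    interpret enumerated_partition j "2 * j ^ k" P "e P"
      using enumerates P by blast
    have "P = P'"
      using first_block_of_interleaving[OF s(1)] eq
        enumerated_partition.first_block_of_interleaving[OF enumerates[OF P(2)] s(2)]
      by (simp add: F_def)
    with eq interleaving_determines_permutation[OF s] show "P = P' \<and> s = s'"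
      by (simp add: F_def)
  qed
  moreover have "F ` (?E \<times> ?S) \<subseteq> equal_power_sum_partitions j (Suc k)"
    using interleaving_in_equal_power_sum_partitions[OF j k] e by (auto simp: F_def)
  ultimately have "card (?E \<times> ?S) \<le> card (equal_power_sum_partitions j (Suc k))"
    using finite_equal_power_sum_partitions by (intro card_inj_on_le)
  moreover have "card ?S = fact (j - 1)"
    by (rule card_permutations) auto
  ultimately show ?thesis
    by (simp add: card_cartesian_product mult.commute)
qed

lemma complementary_pairs_in_equal_power_sum_partitions:
  "(\<lambda>i. {i, 2 * j + 1 - i}) ` {1..j} \<in> equal_power_sum_partitions j 1"
proof -
  let ?pair = "\<lambda>i. {i, 2 * j + 1 - i}"
  have "partition_on {1..2 * j} (?pair ` {1..j})"
  proof (rule partition_onI)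
    show "\<Union> (?pair ` {1..j}) = {1..2 * j}"
    proof (intro equalityI subsetI)
      fix x assume x: "x \<in> {1..2 * j}"
      show "x \<in> \<Union> (?pair ` {1..j})"
      proof (cases "x \<le> j")
        case False
        with x have "2 * j + 1 - x \<in> {1..j}" "x \<in> ?pair (2 * j + 1 - x)" by auto
        then show ?thesis by blast
      qed (use x in auto)
    qed auto
  qed (auto simp: disjnt_iff)
  moreover have "inj_on ?pair {1..j}"
    by (rule inj_onI) (auto simp: doubleton_eq_iff)
  then have "card (?pair ` {1..j}) = j"
    by (simp add: card_image)
  moreover have "card (?pair i) = 2" "\<Sum>(?pair i) = 2 * j + 1" if "i \<in> {1..j}" for i
  proof -
    have "i \<noteq> 2 * j + 1 - i" using that by auto
    then show "card (?pair i) = 2" "\<Sum>(?pair i) = 2 * j + 1" using that by auto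
  qed
  ultimately show ?thesis
    by (auto simp: equal_power_sum_partitions_def)
qed

theorem theorem6:
  fixes j k :: nat
  assumes "j \<ge> 2" and "k \<ge> 1"
  shows "card (equal_power_sum_partitions j k) \<ge> fact (j - 1) ^ (k - 1)"
  using assms(2)
proof (induction k rule: nat_induct_at_least)
  case base
  show ?case
    using complementary_pairs_in_equal_power_sum_partitions[of j]
      finite_equal_power_sum_partitions[of j 1]
    by (auto simp: Suc_le_eq card_gt_0_iff)
next
  case (Suc k)
  have "fact (j - 1) ^ (Suc k - 1) = fact (j - 1) * fact (j - 1) ^ (k - 1)"
    using Suc.hyps by (cases k) auto
  also have "\<dots> \<le> fact (j - 1) * card (equal_power_sum_partitions j k)"
    using Suc.IH by simp
  also have "\<dots> \<le> card (equal_power_sum_partitions j (Suc k))"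
    using assms(1) Suc.hyps by (intro card_equal_power_sum_partitions_Suc) auto
  finally show ?case .
qed

end
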